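(* Let $k\ge 1$ and let $\mathcal{M}=(S,f,\Delta_S)$ be a cycling $k$-machine. Then there exist $\mathcal{M}$-good $k$-uniform directed hypergraphs of arbitrarily large chromatic number if and only if there is an $\mathcal{M}$-compatible order on $S\times[k]$. Furthermore, if the chromatic numbers of $\mathcal{M}$-good $k$-uniform directed hypergraphs are bounded, then every $\mathcal{M}$-good $k$-uniform directed hypergraph has chromatic number at most $|S|!$.
   Context: $[k]=\{1,\dots,k\}$, $\mathcal{P}(S)$ is the power set of $S$, and $\Delta_S=\{(s,s):s\in S\}$. A $k$-uniform directed hypergraph is a pair $\mathcal{H}=(V,E)$ with $E\subseteq V^k$, where no edge $e=(e_1,\dots,e_k)\in E$ has two equal coordinates. Its chromatic number is the least $\chi$ (possibly infinite) such that there is a map $c:V\to[\chi]$ such that for no edge $e\in E$ are $c(e_1),\dots,c(e_k)$ all equal. A $k$-machine is a triple $\mathcal{M}=(S,f,\mathcal{B})$ where $S$ is a finite set of states, $f:S\times[k]^2\to\mathcal{P}(S)$, and $\mathcal{B}\subseteq S\times S$. A cycle of $\mathcal{H}$ is a sequence $c=(v_0,e_1,v_1,\dots,e_n,v_n)$ with $n\ge 0$, $e_i\in E$, $v_n=v_0$, and $v_{i-1},v_i\in\{(e_i)_1,\dots,(e_i)_k\}$ for each $i$; $|c|=n$, and the trace is $\mathrm{tr}(c,i)=(a,b)$ where $(e_i)_a=v_{i-1}$ and $(e_i)_b=v_i$. A cycle $c$ is $\mathcal{M}$-bad if there are states $s_0,\dots,s_n\in S$ with $s_i\in f(s_{i-1},\mathrm{tr}(c,i))$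 for all $1\le i\le n$ and $(s_0,s_n)\in\mathcal{B}$; $\mathcal{H}$ is $\mathcal{M}$-good if it has no $\mathcal{M}$-bad cycle. A cycling $k$-machine is a $k$-machine with $\mathcal{B}=\Delta_S$; for cycling $k$-machines, a cycle $c$ is only considered $\mathcal{M}$-bad if in addition $|c|>0$. An $\mathcal{M}$-compatible order on $S\times[k]$ is a total order $\prec$ on $S\times[k]$ such that the induced orderings on $S\times\{i\}$ agree for all $i\in[k]$ (i.e. $(s,i)\prec(t,i)\iff(s,j)\prec(t,j)$ for all $s,t\in S$, $i,j\in[k]$), and such that whenever $t\in f(s,(i,j))$ we have $(s,i)\prec(t,j)$. *)

theory Defs
  imports Complex_Main "HOL-Library.FuncSet" "HOL-Library.Extended_Nat"
begin

text \<open>A tuple in \<open>V\<^sup>k\<close> is a function in \<open>{1..k} \<rightarrow>\<^sub>E V\<close>; its \<open>i\<close>-th coordinate is \<open>e i\<close>.\<close>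

record 'v dhypergraph =
  verts :: "'v set"
  edges :: "(nat \<Rightarrow> 'v) set"

definition uniform_dhypergraph :: "nat \<Rightarrow> 'v dhypergraph \<Rightarrow> bool" where
  "uniform_dhypergraph k H \<longleftrightarrow>
     edges H \<subseteq> ({1..k} \<rightarrow>\<^sub>E verts H) \<and> (\<forall>e\<in>edges H. inj_on e {1..k})"

definition proper_colouring :: "nat \<Rightarrow> 'v dhypergraph \<Rightarrow> nat \<Rightarrow> ('v \<Rightarrow> nat) \<Rightarrow> bool" where
  "proper_colouring k H m c \<longleftrightarrow>
     c \<in> verts H \<rightarrow> {1..m} \<and>
     (\<forall>e\<in>edges H. \<not> (\<forall>i\<in>{1..k}. \<forall>j\<in>{1..k}. c (e i) = c (e j)))"

text \<open>The infimum of the empty set is \<open>\<infinity>\<close>, so this is \<open>\<infinity>\<close> if there is no proper colouring with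
  finitely many colours.\<close>

definition chromatic_number :: "nat \<Rightarrow> 'v dhypergraph \<Rightarrow> enat" where
  "chromatic_number k H = Inf {enat m | m. \<exists>c. proper_colouring k H m c}"

text \<open>The sequence \<open>(v\<^sub>0, e\<^sub>1, v\<^sub>1, \<dots>, e\<^sub>n, v\<^sub>n)\<close> is given by its length \<open>n\<close> and two functions
  \<open>v\<close> and \<open>e\<close>, whose values outside \<open>{0..n}\<close> and \<open>{1..n}\<close>, respectively, are irrelevant.\<close>

definition is_cycle ::
  "nat \<Rightarrow> 'v dhypergraph \<Rightarrow> nat \<Rightarrow> (nat \<Rightarrow> 'v) \<Rightarrow> (nat \<Rightarrow> nat \<Rightarrow> 'v) \<Rightarrow> bool" where
  "is_cycle k H n v e \<longleftrightarrow>
     (\<forall>i\<in>{0..n}. v i \<in> verts H) \<and> v n = v 0 \<and>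
     (\<forall>i\<in>{1..n}. e i \<in> edges H \<and> v (i - 1) \<in> e i ` {1..k} \<and> v i \<in> e i ` {1..k})"

definition trace :: "nat \<Rightarrow> (nat \<Rightarrow> 'v) \<Rightarrow> (nat \<Rightarrow> nat \<Rightarrow> 'v) \<Rightarrow> nat \<Rightarrow> nat \<times> nat" where
  "trace k v e i =
     (THE a. a \<in> {1..k} \<and> e i a = v (i - 1), THE b. b \<in> {1..k} \<and> e i b = v i)"

record 's machine =
  states :: "'s set"
  transition :: "'s \<Rightarrow> nat \<times> nat \<Rightarrow> 's set"
  bad_pairs :: "('s \<times> 's) set"

definition is_machine :: "nat \<Rightarrow> 's machine \<Rightarrow> bool" where
  "is_machine k M \<longleftrightarrow>
     finite (states M) \<and>
     (\<forall>s\<in>states M. \<forall>i\<in>{1..k}. \<forall>j\<in>{1..k}. transition M s (i, j) \<subseteq> states M) \<and>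
     bad_pairs M \<subseteq> states M \<times> states M"

definition cycling_machine :: "nat \<Rightarrow> 's machine \<Rightarrow> bool" where
  "cycling_machine k M \<longleftrightarrow> is_machine k M \<and> bad_pairs M = Id_on (states M)"

definition bad_cycle ::
  "nat \<Rightarrow> 's machine \<Rightarrow> 'v dhypergraph \<Rightarrow> nat \<Rightarrow> (nat \<Rightarrow> 'v) \<Rightarrow> (nat \<Rightarrow> nat \<Rightarrow> 'v) \<Rightarrow> bool" where
  "bad_cycle k M H n v e \<longleftrightarrow>
     is_cycle k H n v e \<and>
     (\<exists>s. (\<forall>i\<in>{0..n}. s i \<in> states M) \<and>
          (\<forall>i\<in>{1..n}. s i \<in> transition M (s (i - 1)) (trace k v e i)) \<and>
          (s 0, s n) \<in> bad_pairs M) \<and>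
     (cycling_machine k M \<longrightarrow> n > 0)"

definition good_dhypergraph :: "nat \<Rightarrow> 's machine \<Rightarrow> 'v dhypergraph \<Rightarrow> bool" where
  "good_dhypergraph k M H \<longleftrightarrow>
     uniform_dhypergraph k H \<and> (\<nexists>n v e. bad_cycle k M H n v e)"

text \<open>The order is strict: \<open>t \<in> f(s,(i,j))\<close> has to force \<open>(s,i) \<noteq> (t,j)\<close>.\<close>

definition compatible_order :: "nat \<Rightarrow> 's machine \<Rightarrow> (('s \<times> nat) \<times> ('s \<times> nat)) set \<Rightarrow> bool" where
  "compatible_order k M r \<longleftrightarrow>
     r \<subseteq> (states M \<times> {1..k}) \<times> (states M \<times> {1..k}) \<and>
     strict_linear_order_on (states M \<times> {1..k}) r \<and>
     (\<forall>s\<in>states M. \<forall>t\<in>states M. \<forall>i\<in>{1..k}. \<forall>j\<in>{1..k}.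
        ((s, i), (t, i)) \<in> r \<longleftrightarrow> ((s, j), (t, j)) \<in> r) \<and>
     (\<forall>s\<in>states M. \<forall>i\<in>{1..k}. \<forall>j\<in>{1..k}. \<forall>t\<in>transition M s (i, j).
        ((s, i), (t, j)) \<in> r)"

end

theory Submission
  imports Defs "HOL-Library.Ramsey" "HOL-Library.Countable_Set"
    "HOL-Combinatorics.Multiset_Permutations"
begin

text \<open>
  A cycling machine runs on a hypergraph as a step relation on pairs (state, vertex), and the
  hypergraph is good iff this relation is acyclic.

  If it is acyclic, extend it to a linear order and colour each vertex \<open>v\<close> by the order induced on
  \<open>S \<times> {v}\<close>; this takes at most \<open>|S|!\<close> colours. On a monochromatic edge, the linear order pulls back
  to a compatible order on \<open>S \<times> [k]\<close>.

  Conversely, a compatible order enumerates \<open>S \<times> [k]\<close> by positions \<open>p\<close>. Take the \<open>|S|\<close>-element sets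
  of naturals as vertices and, for each strictly increasing \<open>h\<close>, the tuple of sets \<open>h (p (S \<times> {i}))\<close>
  as an edge. Ramsey's theorem gives a monochromatic edge in every finite colouring. Since all
  \<open>S \<times> {i}\<close> carry the same order, the number \<open>h (p (s, i))\<close> depends only on \<open>s\<close> and the
  \<open>i\<close>-th vertex of the edge; it increases along steps, so the step relation is acyclic.
\<close>

section \<open>Linear orders\<close>

text \<open>By Zorn's lemma, applied to the strict partial orders containing \<open>r\<close> (one
  of them is \<open>r\<^sup>+\<close>), there is a maximal one. It is total, since an incomparable
  pair could still be added.\<close>

lemma acyclic_linear_extension:
  assumes "acyclic r"
  obtains q where "r \<subseteq> q" "strict_linear_order_on UNIV q"
proof -
  define A where "A = {q. r \<subseteq> q \<and> trans q \<and> irrefl q}"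
  have "r\<^sup>+ \<in> A"
    using assms by (auto simp: A_def acyclic_irrefl)
  have "\<exists>U\<in>A. \<forall>X\<in>C. X \<subseteq> U" if C: "subset.chain A C" for C
  proof (cases "C = {}")
    case True
    with \<open>r\<^sup>+ \<in> A\<close> show ?thesis by auto
  next
    case False
    have sub: "C \<subseteq> A" and lin: "\<And>X Y. X \<in> C \<Longrightarrow> Y \<in> C \<Longrightarrow> X \<subseteq> Y \<or> Y \<subseteq> X"
      using C by (auto simp: subset_chain_def)
    have "trans (\<Union>C)"
    proof (rule transI)
      fix x y z assume "(x, y) \<in> \<Union>C" "(y, z) \<in> \<Union>C"
      then obtain X Y where XY: "X \<in> C" "Y \<in> C" "(x, y) \<in> X" "(y, z) \<in> Y" by blast
      then obtain Z where "Z \<in> C" "(x, y) \<in> Z" "(y, z) \<in> Z"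
        using lin[of X Y] by blast
      moreover from \<open>Z \<in> C\<close> sub have "trans Z" by (auto simp: A_def)
      ultimately show "(x, z) \<in> \<Union>C" by (meson UnionI transE)
    qed
    moreover have "irrefl (\<Union>C)" using sub by (auto simp: A_def irrefl_def)
    moreover have "r \<subseteq> \<Union>C" using sub False by (force simp: A_def)
    ultimately have "\<Union>C \<in> A" by (simp add: A_def)
    then show ?thesis by blast
  qed
  from subset_Zorn[OF this] obtain q where q: "q \<in> A" and max: "\<And>X. X \<in> A \<Longrightarrow> q \<subseteq> X \<Longrightarrow> X = q"
    by blast
  have tr: "trans q" and irr: "irrefl q" and rq: "r \<subseteq> q" using q by (auto simp: A_def)
  have "total_on UNIV q"
  proof (rule total_onI, rule ccontr)
    fix a b assume ab: "a \<noteq> b" "\<not> ((a, b) \<in> q \<or> (b, a) \<in> q)"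
    \<comment> \<open>\<open>q'\<close> is the transitive closure of \<open>q\<close> with
      \<open>(a, b)\<close> added. By \<open>sep\<close> below, no point lies weakly above
      \<open>b\<close> and weakly below \<open>a\<close>, so two new pairs never compose and no new
      pair is a loop.\<close>
    define q' where "q' = q \<union> {(x, y). (x = a \<or> (x, a) \<in> q) \<and> (y = b \<or> (b, y) \<in> q)}"
    have q_trans: "(x, z) \<in> q" if "(x, y) \<in> q" "(y, z) \<in> q" for x y z
      using tr that by (rule transD)
    have sep: "\<not> ((y = b \<or> (b, y) \<in> q) \<and> (y = a \<or> (y, a) \<in> q))" for y
      using ab q_trans[of b y a] by auto
    have "trans q'"
    proof (rule transI)
      fix x y z assume "(x, y) \<in> q'" "(y, z) \<in> q'"
      then show "(x, z) \<in> q'"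
        using sep[of y] q_trans[of x y z] q_trans[of x y a] q_trans[of b y z]
        unfolding q'_def by blast
    qed
    moreover have "irrefl q'"
      using sep irr unfolding q'_def irrefl_def by blast
    ultimately have "q' \<in> A" using rq by (auto simp: A_def q'_def)
    from max[OF this] have "q' = q" by (auto simp: q'_def)
    moreover have "(a, b) \<in> q'" by (auto simp: q'_def)
    ultimately show False using ab by simp
  qed
  with tr irr rq that show thesis by (auto simp: strict_linear_order_on_def)
qed

definition rank :: "'a set \<Rightarrow> ('a \<times> 'a) set \<Rightarrow> 'a \<Rightarrow> nat" where
  "rank A r x = card {y \<in> A. (y, x) \<in> r}"

lemma rank_mono:
  assumes "finite A" "strict_linear_order_on A r" "x \<in> A" "(x, y) \<in> r"
  shows "rank A r x < rank A r y"
  unfolding rank_def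
proof (rule psubset_card_mono)
  have "trans r" "irrefl r" using assms by (auto simp: strict_linear_order_on_def)
  then show "{z \<in> A. (z, x) \<in> r} \<subset> {z \<in> A. (z, y) \<in> r}"
    using assms(3,4) unfolding trans_def irrefl_def by blast
qed (use assms in auto)

lemma rank_less_iff:
  assumes "finite A" "strict_linear_order_on A r" "x \<in> A" "y \<in> A"
  shows "rank A r x < rank A r y \<longleftrightarrow> (x, y) \<in> r"
proof -
  have "x = y \<or> (x, y) \<in> r \<or> (y, x) \<in> r"
    using assms unfolding strict_linear_order_on_def total_on_def by blast
  then show ?thesis
    using rank_mono[OF assms(1,2,3), of y] rank_mono[OF assms(1,2,4), of x] by fastforce
qed

lemma inj_on_rank:
  assumes "finite A" "strict_linear_order_on A r"
  shows "inj_on (rank A r) A"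
proof (rule inj_onI, rule ccontr)
  fix x y assume xy: "x \<in> A" "y \<in> A" "rank A r x = rank A r y" "x \<noteq> y"
  then have "(x, y) \<in> r \<or> (y, x) \<in> r"
    using assms(2) unfolding strict_linear_order_on_def total_on_def by blast
  with xy show False using rank_mono[OF assms, of x y] rank_mono[OF assms, of y x] by auto
qed

text \<open>No element precedes itself, so ranks stay below \<open>card A\<close>; being injective,
  they fill this range.\<close>

lemma rank_image:
  assumes "finite A" "strict_linear_order_on A r"
  shows "rank A r ` A = {..<card A}"
proof (rule card_subset_eq)
  show "rank A r ` A \<subseteq> {..<card A}"
  proof clarsimp
    fix x assume "x \<in> A"
    then have "{y \<in> A. (y, x) \<in> r} \<subset> A"
      using assms(2) by (auto simp: strict_linear_order_on_def irrefl_def)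
    then show "rank A r x < card A"
      unfolding rank_def by (rule psubset_card_mono[OF assms(1)])
  qed
qed (use card_image[OF inj_on_rank[OF assms]] in auto)

section \<open>The step relation\<close>

definition step_rel ::
    "nat \<Rightarrow> 's machine \<Rightarrow> 'v dhypergraph \<Rightarrow> (('s \<times> 'v) \<times> ('s \<times> 'v)) set" where
  "step_rel k M H = {((s, e i), (t, e j)) | s t e i j.
     s \<in> states M \<and> e \<in> edges H \<and> i \<in> {1..k} \<and> j \<in> {1..k} \<and> t \<in> transition M s (i, j)}"

text \<open>Injectivity of the edge makes both positions unique, so the definite descriptions in
  \<open>trace\<close> denote them.\<close>

lemma trace_eq:
  assumes "inj_on (e n) {1..k}" "a \<in> {1..k}" "b \<in> {1..k}" "e n a = v (n - 1)" "e n b = v n"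
  shows "trace k v e n = (a, b)"
proof -
  have "(THE x. x \<in> {1..k} \<and> e n x = v (n - 1)) = a"
    using assms(2,4) inj_onD[OF assms(1)] by (intro the_equality) metis+
  moreover have "(THE x. x \<in> {1..k} \<and> e n x = v n) = b"
    using assms(3,5) inj_onD[OF assms(1)] by (intro the_equality) metis+
  ultimately show ?thesis by (simp only: trace_def)
qed

text \<open>A closed walk of positive length in the step relation amounts to a cycle with a run of
  states along it. As the bad pairs form the diagonal, equality of the endpoints says both
  \<open>v n = v 0\<close> and that the run is bad.\<close>

lemma good_iff_acyclic_step_rel:
  assumes M: "cycling_machine k M" and H: "uniform_dhypergraph k H"
  shows "good_dhypergraph k M H \<longleftrightarrow> acyclic (step_rel k M H)"
proof
  assume good: "good_dhypergraph k M H"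
  show "acyclic (step_rel k M H)"
    unfolding acyclic_def
  proof (intro allI notI)
    fix x assume "(x, x) \<in> (step_rel k M H)\<^sup>+"
    then obtain n w where n: "n > 0" and w: "w 0 = x" "w n = x"
      and step: "\<And>i. i < n \<Longrightarrow> (w i, w (Suc i)) \<in> step_rel k M H"
      unfolding trancl_power relpow_fun_conv by blast
    define Q where "Q i e a b \<longleftrightarrow> fst (w i) \<in> states M \<and> e \<in> edges H \<and> a \<in> {1..k} \<and> b \<in> {1..k} \<and>
        e a = snd (w i) \<and> e b = snd (w (Suc i)) \<and> fst (w (Suc i)) \<in> transition M (fst (w i)) (a, b)"
      for i e a b
    have "\<exists>e a b. Q i e a b" if "i < n" for i
    proof -
      obtain s t e a b where "w i = (s, e a)" "w (Suc i) = (t, e b)" "s \<in> states M" "e \<in> edges H"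
        "a \<in> {1..k}" "b \<in> {1..k}" "t \<in> transition M s (a, b)"
        using step[OF \<open>i < n\<close>] unfolding step_rel_def by blast
      then have "Q i e a b" by (simp add: Q_def)
      then show ?thesis by blast
    qed
    then obtain E a b where E: "\<And>i. i < n \<Longrightarrow> Q i (E i) (a i) (b i)"
      by metis
    define v where "v i = snd (w i)" for i
    \<comment> \<open>The step from \<open>w i\<close> to \<open>w (Suc i)\<close> uses the edge
      with number \<open>Suc i\<close> in the cycle.\<close>
    define e where "e i = E (i - 1)" for i
    define s where "s i = fst (w i)" for i
    have less: "i - 1 < n" "Suc (i - 1) = i" if "i \<in> {1..n}" for i using that by auto
    have E': "s (i - 1) \<in> states M" "e i \<in> edges H" "a (i - 1) \<in> {1..k}" "b (i - 1) \<in> {1..k}"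
      "e i (a (i - 1)) = v (i - 1)" "e i (b (i - 1)) = v i"
      "s i \<in> transition M (s (i - 1)) (a (i - 1), b (i - 1))" if "i \<in> {1..n}" for i
      using E[OF less(1)[OF that]] unfolding Q_def v_def e_def s_def less(2)[OF that] by blast+
    have ends: "v n = v 0" "s n = s 0" using w by (auto simp: v_def s_def)
    have tr: "trace k v e i = (a (i - 1), b (i - 1))" if "i \<in> {1..n}" for i
      using E'(2)[OF that] H
      by (intro trace_eq E'(3-6) that) (simp add: uniform_dhypergraph_def)
    \<comment> \<open>Membership is read off from the step that starts at index \<open>i\<close>. No
      step starts at \<open>n\<close>, so that index is reduced to 0 by \<open>ends\<close>.\<close>
    have vH: "v i \<in> verts H" and sM: "s i \<in> states M" if "i < n" for i
    proof -
      have "Suc i \<in> {1..n}" using that by auto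
      note E = E'[OF this]
      show "s i \<in> states M" using E(1) by simp
      have "e (Suc i) \<in> {1..k} \<rightarrow>\<^sub>E verts H"
        using E(2) H unfolding uniform_dhypergraph_def by blast
      from PiE_mem[OF this E(3)] show "v i \<in> verts H" using E(5) by simp
    qed
    have vH': "v i \<in> verts H" and sM': "s i \<in> states M" if "i \<le> n" for i
      using vH[of i] sM[of i] vH[of 0] sM[of 0] ends n that by (cases "i = n"; simp)+
    have "is_cycle k H n v e"
      unfolding is_cycle_def
    proof (intro conjI ballI)
      fix i assume i: "i \<in> {1..n}"
      show "e i \<in> edges H" by (rule E'(2)[OF i])
      show "v (i - 1) \<in> e i ` {1..k}" "v i \<in> e i ` {1..k}"
        using imageI[OF E'(3)[OF i], of "e i"] imageI[OF E'(4)[OF i], of "e i"] E'(5,6)[OF i]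
        by simp_all
    qed (use vH' ends in auto)
    moreover have "\<forall>i\<in>{1..n}. s i \<in> transition M (s (i - 1)) (trace k v e i)"
      using E'(7) tr by simp
    moreover have "(s 0, s n) \<in> bad_pairs M"
      using M ends sM'[of 0] by (auto simp: cycling_machine_def)
    ultimately have "bad_cycle k M H n v e"
      unfolding bad_cycle_def using sM' n by (intro conjI exI[of _ s]) auto
    with good show False by (auto simp: good_dhypergraph_def)
  qed
next
  assume ac: "acyclic (step_rel k M H)"
  have False if "bad_cycle k M H n v e" for n v e
  proof -
    from that M have n: "n > 0" and cyc: "is_cycle k H n v e" by (auto simp: bad_cycle_def)
    from that obtain s where s1: "\<forall>i\<in>{0..n}. s i \<in> states M"
      and s2: "\<forall>i\<in>{1..n}. s i \<in> transition M (s (i - 1)) (trace k v e i)"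
      and s3: "(s 0, s n) \<in> bad_pairs M"
      unfolding bad_cycle_def by blast
    have eq: "s 0 = s n" using s3 M by (auto simp: cycling_machine_def)
    have "((s i, v i), (s (Suc i), v (Suc i))) \<in> step_rel k M H" if "i < n" for i
    proof -
      have i: "Suc i \<in> {1..n}" using that by auto
      with cyc obtain a b where ab: "e (Suc i) \<in> edges H" "a \<in> {1..k}" "b \<in> {1..k}"
        "e (Suc i) a = v i" "e (Suc i) b = v (Suc i)"
        unfolding is_cycle_def by (metis diff_Suc_1 imageE)
      have "trace k v e (Suc i) = (a, b)"
        using ab H by (intro trace_eq) (simp_all add: uniform_dhypergraph_def)
      then have "s (Suc i) \<in> transition M (s i) (a, b)" using s2 i by (metis diff_Suc_1)
      moreover have "s i \<in> states M" using s1 that by simp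
      ultimately have "((s i, e (Suc i) a), (s (Suc i), e (Suc i) b)) \<in> step_rel k M H"
        unfolding step_rel_def using ab(1-3) by blast
      then show ?thesis by (simp only: ab(4,5))
    qed
    then have "((s 0, v 0), (s n, v n)) \<in> (step_rel k M H) ^^ n"
      unfolding relpow_fun_conv by (intro exI[of _ "\<lambda>i. (s i, v i)"]) auto
    then have "((s 0, v 0), (s 0, v 0)) \<in> (step_rel k M H)\<^sup>+"
      unfolding trancl_power using n eq cyc by (auto simp: is_cycle_def)
    with ac show False by (auto simp: acyclic_def)
  qed
  with H show "good_dhypergraph k M H" by (auto simp: good_dhypergraph_def)
qed

section \<open>Colouring good hypergraphs\<close>

text \<open>This allows colours from any finite set, so that orders coded as permutations can serve
  as colours. A bijection turns them into numbers, shifted by \<open>Suc\<close> because colours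
  start at 1.\<close>

lemma chromatic_number_le_card:
  assumes "finite P" "\<And>v. v \<in> verts H \<Longrightarrow> col v \<in> P"
    and "\<And>e. e \<in> edges H \<Longrightarrow> \<not> (\<forall>i\<in>{1..k}. \<forall>j\<in>{1..k}. col (e i) = col (e j))"
    and "edges H \<subseteq> {1..k} \<rightarrow>\<^sub>E verts H"
  shows "chromatic_number k H \<le> enat (card P)"
proof -
  from ex_bij_betw_finite_nat[OF assms(1)] obtain h where h: "bij_betw h P {0..<card P}" by blast
  have hP: "h x < card P" if "x \<in> P" for x
    using h that by (auto simp: bij_betw_def)
  have "proper_colouring k H (card P) (\<lambda>v. Suc (h (col v)))"
    unfolding proper_colouring_def
  proof (intro conjI ballI)
    show "(\<lambda>v. Suc (h (col v))) \<in> verts H \<rightarrow> {1..card P}"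
      using hP assms(2) by (auto simp: Suc_le_eq)
  next
    fix e assume e: "e \<in> edges H"
    then have "e i \<in> verts H" if "i \<in> {1..k}" for i
      using assms(4) that by (blast dest: PiE_mem)
    then have "h (col (e i)) = h (col (e j)) \<longleftrightarrow> col (e i) = col (e j)"
      if "i \<in> {1..k}" "j \<in> {1..k}" for i j
      using that h assms(2) by (intro inj_on_eq_iff[of h P]) (auto simp: bij_betw_def)
    with assms(3)[OF e]
    show "\<not> (\<forall>i\<in>{1..k}. \<forall>j\<in>{1..k}. Suc (h (col (e i))) = Suc (h (col (e j))))" by auto
  qed
  then show ?thesis unfolding chromatic_number_def by (intro Inf_lower) blast
qed

text \<open>By \<open>mono\<close>, \<open>q\<close> orders the states in the same way at all
  vertices of \<open>e\<close>, which gives the agreement condition. The coordinates of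
  \<open>e\<close> are distinct, so distinct pairs \<open>(s, i)\<close> have distinct images
  \<open>(s, e i)\<close> and the pullback of \<open>q\<close> is total.\<close>

lemma compatible_order_pullback:
  assumes M: "cycling_machine k M" and H: "uniform_dhypergraph k H" and e: "e \<in> edges H"
    and q: "strict_linear_order_on UNIV q" "step_rel k M H \<subseteq> q"
    and mono: "\<And>s t i j. s \<in> states M \<Longrightarrow> t \<in> states M \<Longrightarrow> i \<in> {1..k} \<Longrightarrow> j \<in> {1..k} \<Longrightarrow>
      ((s, e i), (t, e i)) \<in> q \<Longrightarrow> ((s, e j), (t, e j)) \<in> q"
  shows "\<exists>r. compatible_order k M r"
proof -
  define A where "A = states M \<times> {1..k}"
  define r where "r = inv_image q (map_prod id e) \<inter> A \<times> A"
  have r_iff: "((s, i), (t, j)) \<in> r \<longleftrightarrow> (s, i) \<in> A \<and> (t, j) \<in> A \<and> ((s, e i), (t, e j)) \<in> q" for s i t j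
    by (auto simp: r_def)
  have inj: "inj_on e {1..k}" using H e by (auto simp: uniform_dhypergraph_def)
  have lin: "trans q" "irrefl q" "total_on UNIV q"
    using q(1) by (auto simp: strict_linear_order_on_def)
  have "trans r" unfolding r_def by (intro trans_Int trans_inv_image lin(1)) (auto simp: trans_def)
  moreover have "irrefl r" using lin(2) by (auto simp: irrefl_def r_def)
  moreover have "total_on A r"
  proof (rule total_onI)
    fix x y assume xy: "x \<in> A" "y \<in> A" "x \<noteq> y"
    obtain s i t j where [simp]: "x = (s, i)" "y = (t, j)" by fastforce
    have "(s, e i) \<noteq> (t, e j)" using xy inj by (auto simp: A_def dest: inj_onD)
    with lin(3) have "((s, e i), (t, e j)) \<in> q \<or> ((t, e j), (s, e i)) \<in> q"
      by (meson UNIV_I total_on_def)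
    with xy show "(x, y) \<in> r \<or> (y, x) \<in> r" by (simp add: r_iff)
  qed
  moreover have "((s, i), (t, j)) \<in> r"
    if "s \<in> states M" "i \<in> {1..k}" "j \<in> {1..k}" "t \<in> transition M s (i, j)" for s t i j
  proof -
    have "t \<in> states M" using M that unfolding cycling_machine_def is_machine_def by blast
    moreover have "((s, e i), (t, e j)) \<in> step_rel k M H"
      unfolding step_rel_def using that e by blast
    ultimately show ?thesis using q(2) that by (auto simp: r_iff A_def)
  qed
  moreover have "((s, i), (t, i)) \<in> r \<longleftrightarrow> ((s, j), (t, j)) \<in> r"
    if "s \<in> states M" "t \<in> states M" "i \<in> {1..k}" "j \<in> {1..k}" for s t i j
    unfolding r_iff A_def using mono[of s t i j] mono[of s t j i] that by blast
  moreover have "r \<subseteq> A \<times> A" by (auto simp: r_def)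
  ultimately have "compatible_order k M r"
    unfolding compatible_order_def strict_linear_order_on_def A_def by blast
  then show ?thesis ..
qed

lemma chromatic_number_le_fact:
  assumes M: "cycling_machine k M" and good: "good_dhypergraph k M H"
    and no: "\<nexists>r. compatible_order k M r"
  shows "chromatic_number k H \<le> enat (fact (card (states M)))"
proof -
  let ?S = "states M"
  have fin: "finite ?S" using M by (auto simp: cycling_machine_def is_machine_def)
  have H: "uniform_dhypergraph k H" using good by (auto simp: good_dhypergraph_def)
  from good have "acyclic (step_rel k M H)" using good_iff_acyclic_step_rel[OF M H] by blast
  then obtain q where q: "step_rel k M H \<subseteq> q" "strict_linear_order_on UNIV q"
    by (rule acyclic_linear_extension)
  define o_at where "o_at v = inv_image q (\<lambda>s. (s, v))" for v
  have lin: "strict_linear_order_on ?S (o_at v)" for v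
    using q(2) unfolding strict_linear_order_on_def o_at_def
    by (intro conjI trans_inv_image) (simp_all add: irrefl_def total_on_def)
  obtain xs where xs: "set xs = ?S" "distinct xs" using finite_distinct_list[OF fin] by blast
  \<comment> \<open>The colour lists the ranks of the states along the fixed enumeration
    \<open>xs\<close>. It determines the order at \<open>v\<close> on the states, and it is a
    permutation of \<open>{..<card ?S}\<close>, whence the factorial.\<close>
  define col where "col v = map (rank ?S (o_at v)) xs" for v
  have col: "col v \<in> permutations_of_set {..<card ?S}" for v
    using xs rank_image[OF fin lin] inj_on_rank[OF fin lin]
    by (auto simp: col_def distinct_map intro!: permutations_of_setI)
  have "\<not> (\<forall>i\<in>{1..k}. \<forall>j\<in>{1..k}. col (e i) = col (e j))" if e: "e \<in> edges H" for e
  proof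
    assume mono: "\<forall>i\<in>{1..k}. \<forall>j\<in>{1..k}. col (e i) = col (e j)"
    have "((s, e j), (t, e j)) \<in> q"
      if st: "s \<in> ?S" "t \<in> ?S" and ij: "i \<in> {1..k}" "j \<in> {1..k}" and "((s, e i), (t, e i)) \<in> q"
      for s t i j
    proof -
      have "col (e i) = col (e j)" using mono ij by blast
      then have "rank ?S (o_at (e i)) u = rank ?S (o_at (e j)) u" if "u \<in> ?S" for u
        using that xs by (auto simp: col_def)
      moreover have "(s, t) \<in> o_at (e i)" using that by (simp add: o_at_def)
      ultimately have "(s, t) \<in> o_at (e j)"
        using st by (simp flip: rank_less_iff[OF fin lin])
      then show ?thesis by (simp add: o_at_def)
    qed
    with no compatible_order_pullback[OF M H e q(2,1)] show False by blast
  qed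
  then have "chromatic_number k H \<le> enat (card (permutations_of_set {..<card ?S}))"
    using H col by (intro chromatic_number_le_card[where col = col]) (auto simp: uniform_dhypergraph_def)
  then show ?thesis by simp
qed

section \<open>Good hypergraphs of infinite chromatic number\<close>

lemma chromatic_number_infinite:
  assumes "\<And>(n::nat) c. c \<in> verts H \<rightarrow> {1..n} \<Longrightarrow>
    \<exists>e\<in>edges H. \<forall>i\<in>{1..k}. \<forall>j\<in>{1..k}. c (e i) = c (e j)"
  shows "chromatic_number k H = \<infinity>"
proof -
  have none: "\<not> proper_colouring k H n c" for n c
    using assms[of c n] unfolding proper_colouring_def by blast
  have "{enat m | m. \<exists>c. proper_colouring k H m c} = {}" using none by blast
  then show ?thesis by (simp only: chromatic_number_def Inf_empty top_enat_def)
qed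

text \<open>Without states, all coordinates of an edge of the Ramsey construction would be the empty set,
  so this case is treated separately.\<close>

lemma infinite_chromatic_number_no_states:
  assumes "cycling_machine k M" "states M = {}" and inf: "infinite (UNIV :: 'v set)"
  shows "\<exists>H :: 'v dhypergraph. good_dhypergraph k M H \<and> chromatic_number k H = \<infinity>"
proof -
  \<comment> \<open>Without states the step relation is empty, so even the complete hypergraph is
    good.\<close>
  define H :: "'v dhypergraph"
    where "H = \<lparr>verts = UNIV, edges = {e \<in> {1..k} \<rightarrow>\<^sub>E UNIV. inj_on e {1..k}}\<rparr>"
  have "uniform_dhypergraph k H" by (auto simp: uniform_dhypergraph_def H_def)
  moreover have "acyclic (step_rel k M H)" using assms by (auto simp: step_rel_def acyclic_def)
  ultimately have "good_dhypergraph k M H"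
    using good_iff_acyclic_step_rel[OF assms(1)] by blast
  moreover have "chromatic_number k H = \<infinity>"
  proof (rule chromatic_number_infinite)
    fix n c assume c: "c \<in> verts H \<rightarrow> {1..n::nat}"
    then have "range c \<subseteq> {1..n}" by (auto simp: H_def)
    then have "finite (range c)" by (rule finite_subset) simp
    \<comment> \<open>Some colour class is infinite; any \<open>k\<close> distinct vertices in it
      form a monochromatic edge.\<close>
    then obtain x where "infinite {y. c y = c x}"
      using pigeonhole_infinite[OF inf] by auto
    then obtain g :: "nat \<Rightarrow> 'v" where g: "inj g" "range g \<subseteq> {y. c y = c x}"
      using infinite_countable_subset by blast
    have "restrict g {1..k} \<in> edges H"
      using g(1) by (auto simp: H_def inj_on_def)
    moreover have "c (g i) = c x" for i using g(2) by auto
    ultimately show "\<exists>e\<in>edges H. \<forall>i\<in>{1..k}. \<forall>j\<in>{1..k}. c (e i) = c (e j)"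
      by (intro bexI[of _ "restrict g {1..k}"]) auto
  qed
  ultimately show ?thesis by blast
qed

text \<open>There are only countably many finite sets of naturals, so they can be coded as vertices
  in any infinite type.\<close>

lemma finite_nat_sets_embedding:
  assumes "infinite (UNIV :: 'v set)"
  obtains g :: "nat set \<Rightarrow> 'v" where "inj_on g {X. finite X}"
proof -
  obtain f :: "nat \<Rightarrow> 'v" where f: "inj f"
    using infinite_countable_subset[OF assms] by blast
  have "inj_on (to_nat_on (Collect finite :: nat set set)) (Collect finite)"
    by (intro inj_on_to_nat_on countable_Collect_finite)
  with f have "inj_on (f \<circ> to_nat_on (Collect finite)) (Collect finite :: nat set set)"
    by (intro comp_inj_on) (auto intro: inj_on_subset)
  with that show thesis by blast
qed

lemma infinite_chromatic_number_if_compatible_order: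
  assumes M: "cycling_machine k M" and S: "states M \<noteq> {}"
    and r: "compatible_order k M r" and inf: "infinite (UNIV :: 'v set)"
  shows "\<exists>H :: 'v dhypergraph. good_dhypergraph k M H \<and> chromatic_number k H = \<infinity>"
proof -
  let ?S = "states M"
  let ?A = "?S \<times> {1..k}"
  have fin: "finite ?S" and finA: "finite ?A"
    using M by (auto simp: cycling_machine_def is_machine_def)
  have lin: "strict_linear_order_on ?A r" using r by (simp add: compatible_order_def)
  have agree: "((s, i), (t, i)) \<in> r \<longleftrightarrow> ((s, j), (t, j)) \<in> r"
    if "s \<in> ?S" "t \<in> ?S" "i \<in> {1..k}" "j \<in> {1..k}" for s t i j
    using r that unfolding compatible_order_def by blast
  define p where "p = rank ?A r"
  have p_less: "p x < p y \<longleftrightarrow> (x, y) \<in> r" if "x \<in> ?A" "y \<in> ?A" for x y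
    using rank_less_iff[OF finA lin that] by (simp add: p_def)
  have p_eq: "p x = p y \<longleftrightarrow> x = y" if "x \<in> ?A" "y \<in> ?A" for x y
    using inj_on_eq_iff[OF inj_on_rank[OF finA lin] that] by (simp add: p_def)
  obtain g :: "nat set \<Rightarrow> 'v" where g: "inj_on g {X. finite X}"
    using finite_nat_sets_embedding[OF inf] .
  \<comment> \<open>\<open>g (X h i)\<close> is the code of the \<open>i\<close>-th set of the edge
    given by \<open>h\<close>. Injectivity of \<open>g\<close> is available on finite sets, and each
    \<open>X h i\<close> is finite.\<close>
  define X where "X h i = (\<lambda>s. h (p (s, i))) ` ?S" for h :: "nat \<Rightarrow> nat" and i
  define edge where "edge h = (\<lambda>i\<in>{1..k}. g (X h i))" for h
  define H where "H = \<lparr>verts = range g, edges = edge ` {h. strict_mono h}\<rparr>"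
  have finX: "finite (X h i)" for h i using fin by (simp add: X_def)
  have inj_h: "inj_on (\<lambda>s. h (p (s, i))) ?S" if "strict_mono h" "i \<in> {1..k}" for h i
    using that p_eq by (auto simp: inj_on_def strict_mono_eq)
  have unif: "uniform_dhypergraph k H"
    unfolding uniform_dhypergraph_def
  proof (intro conjI ballI)
    show "edges H \<subseteq> {1..k} \<rightarrow>\<^sub>E verts H" by (auto simp: H_def edge_def)
  next
    fix e assume "e \<in> edges H"
    then obtain h where h: "strict_mono h" and e: "e = edge h" by (auto simp: H_def)
    show "inj_on e {1..k}"
    proof (rule inj_onI)
      \<comment> \<open>Since \<open>h\<close> and \<open>p\<close> are injective, different
        coordinates have disjoint sets; these are nonempty because there is a state, hence
        different.\<close>
      fix i j assume ij: "i \<in> {1..k}" "j \<in> {1..k}" and "e i = e j"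
      then have "X h i = X h j"
        using inj_onD[OF g, of "X h i" "X h j"] finX by (simp add: e edge_def)
      moreover obtain s where s: "s \<in> ?S" using S by blast
      ultimately obtain t where "t \<in> ?S" "h (p (s, i)) = h (p (t, j))"
        unfolding X_def by blast
      with h have "p (s, i) = p (t, j)" by (simp add: strict_mono_eq)
      with p_eq ij s \<open>t \<in> ?S\<close> show "i = j" by auto
    qed
  qed
  \<comment> \<open>\<open>\<phi> s v\<close> is the element of the set coded by \<open>v\<close> that has as many predecessors in this set as
    \<open>s\<close> has in \<open>S\<close>.\<close>
  define count where "count Y y = card {z \<in> Y. z < y}" for Y and y :: nat
  define pos where "pos s = card {t \<in> ?S. ((t, 1), (s, 1)) \<in> r}" for s
  define \<phi> where "\<phi> s v = (let Y = inv_into {X. finite X} g v in inv_into Y (count Y) (pos s))"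
    for s v
  have inj_count: "inj_on (count Y) Y" if "finite Y" for Y
  proof (rule linorder_inj_onI')
    fix y z assume "y \<in> Y" "z \<in> Y" "y < z"
    then have "{u \<in> Y. u < y} \<subset> {u \<in> Y. u < z}" by auto
    with that have "count Y y < count Y z"
      unfolding count_def by (intro psubset_card_mono) auto
    then show "count Y y \<noteq> count Y z" by simp
  qed
  \<comment> \<open>An increasing \<open>h\<close> copies the order \<open>r\<close> on
    \<open>S\<close> x \<open>{i}\<close> to \<open>X h i\<close>. By \<open>agree\<close>, the
    number of predecessors of \<open>s\<close> is the same at every coordinate, so
    \<open>pos\<close> may be computed at coordinate 1.\<close>
  have \<phi>: "\<phi> s (edge h i) = h (p (s, i))" if h: "strict_mono h" and s: "s \<in> ?S" and i: "i \<in> {1..k}"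
    for h s i
  proof -
    have 1: "1 \<in> {1..k}" using i by auto
    have "{z \<in> X h i. z < h (p (s, i))} = (\<lambda>t. h (p (t, i))) ` {t \<in> ?S. ((t, i), (s, i)) \<in> r}"
      using h s i p_less by (auto simp: X_def strict_mono_less)
    also have "{t \<in> ?S. ((t, i), (s, i)) \<in> r} = {t \<in> ?S. ((t, 1), (s, 1)) \<in> r}"
      using agree[OF _ s i 1] by blast
    finally have "count (X h i) (h (p (s, i))) = pos s"
      unfolding count_def pos_def
      using inj_on_subset[OF inj_h[OF h i]] by (simp add: card_image)
    then have "inv_into (X h i) (count (X h i)) (pos s) = h (p (s, i))"
      using inj_count[OF finX] s by (intro inv_into_f_eq) (auto simp: X_def)
    moreover have "inv_into {X. finite X} g (edge h i) = X h i"
      using g finX i by (simp add: edge_def)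
    ultimately show ?thesis by (simp add: \<phi>_def Let_def)
  qed
  \<comment> \<open>\<open>\<phi>\<close> is a potential that does not depend on the edge through
    which a vertex is reached. Its increase along single steps therefore rules out closed walks
    across several edges.\<close>
  have "step_rel k M H \<subseteq> inv_image {(a, b). a < b} (\<lambda>(s, v). \<phi> s v)"
  proof
    fix x assume "x \<in> step_rel k M H"
    then obtain s t h i j where x: "x = ((s, edge h i), (t, edge h j))" and h: "strict_mono h"
      and st: "s \<in> ?S" "i \<in> {1..k}" "j \<in> {1..k}" "t \<in> transition M s (i, j)"
      unfolding step_rel_def H_def by auto
    have t: "t \<in> ?S" using M st unfolding cycling_machine_def is_machine_def by blast
    have "((s, i), (t, j)) \<in> r" using r st unfolding compatible_order_def by blast
    then have "p (s, i) < p (t, j)" using p_less st t by auto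
    then have "\<phi> s (edge h i) < \<phi> t (edge h j)"
      using \<phi> h st t by (simp add: strict_mono_less)
    then show "x \<in> inv_image {(a, b). a < b} (\<lambda>(s, v). \<phi> s v)" by (simp add: x)
  qed
  then have "acyclic (step_rel k M H)"
    by (intro wf_acyclic wf_subset[OF wf_inv_image[OF wf]])
  then have good: "good_dhypergraph k M H"
    using good_iff_acyclic_step_rel[OF M unif] by blast
  have "chromatic_number k H = \<infinity>"
  proof (rule chromatic_number_infinite)
    fix n c assume c: "c \<in> verts H \<rightarrow> {1..n::nat}"
    then have "c (g Y) < Suc n" for Y by (auto simp: H_def Pi_iff less_Suc_eq_le)
    \<comment> \<open>Ramsey's theorem is applied to colours below \<open>Suc n\<close>. Enumerating
      the homogeneous set \<open>Y\<close> by \<open>h\<close> makes every \<open>X h i\<close> a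
      subset of \<open>Y\<close> of size \<open>card ?S\<close>.\<close>
    then obtain Y u where Y: "infinite Y"
      and hom: "\<And>Z. Z \<subseteq> Y \<Longrightarrow> finite Z \<Longrightarrow> card Z = card ?S \<Longrightarrow> c (g Z) = u"
      using Ramsey[of "UNIV :: nat set" "card ?S" "c \<circ> g" "Suc n"] by auto
    define h where "h = enumerate Y"
    have h: "strict_mono h" unfolding h_def using strict_mono_enumerate[OF Y] .
    have "c (edge h i) = u" if i: "i \<in> {1..k}" for i
    proof -
      have "X h i \<subseteq> Y" using enumerate_in_set[OF Y] by (auto simp: X_def h_def)
      moreover have "card (X h i) = card ?S"
        unfolding X_def by (rule card_image[OF inj_h[OF h i]])
      ultimately show ?thesis using hom finX i by (simp add: edge_def)
    qed
    then show "\<exists>e\<in>edges H. \<forall>i\<in>{1..k}. \<forall>j\<in>{1..k}. c (e i) = c (e j)"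
      using h by (intro bexI[of _ "edge h"]) (auto simp: H_def)
  qed
  with good show ?thesis by blast
qed

theorem theorem1:
  fixes k :: nat and M :: "'s machine"
  assumes "k \<ge> 1"
    and "cycling_machine k M"
    and "infinite (UNIV :: 'v set)"
  shows "((\<forall>n::nat. \<exists>H :: 'v dhypergraph. good_dhypergraph k M H \<and> chromatic_number k H \<ge> enat n)
            \<longleftrightarrow> (\<exists>r. compatible_order k M r))
       \<and> ((\<exists>n::nat. \<forall>H :: 'v dhypergraph. good_dhypergraph k M H \<longrightarrow> chromatic_number k H \<le> enat n)
            \<longrightarrow> (\<forall>H :: 'v dhypergraph. good_dhypergraph k M H \<longrightarrow>
                   chromatic_number k H \<le> enat (fact (card (states M)))))"
proof (cases "\<exists>r. compatible_order k M r")
  case True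
  \<comment> \<open>A single hypergraph of infinite chromatic number meets every lower bound and
    refutes the premise of the second claim.\<close>
  then obtain H :: "'v dhypergraph"
    where H: "good_dhypergraph k M H" "chromatic_number k H = \<infinity>"
    using infinite_chromatic_number_no_states[OF assms(2) _ assms(3)]
      infinite_chromatic_number_if_compatible_order[OF assms(2) _ _ assms(3)] by blast
  have "enat n \<le> chromatic_number k H" "\<not> chromatic_number k H \<le> enat n" for n
    using H(2) by simp_all
  with True H(1) show ?thesis by blast
next
  case False
  have bound: "chromatic_number k H \<le> enat (fact (card (states M)))"
    if "good_dhypergraph k M H" for H :: "'v dhypergraph"
    using chromatic_number_le_fact[OF assms(2) that False] .
  \<comment> \<open>The left side of the equivalence already fails at one more than the
    factorial.\<close>
  have "\<not> enat (Suc (fact (card (states M)))) \<le> chromatic_number k H"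
    if "good_dhypergraph k M H" for H :: "'v dhypergraph"
    using bound[OF that] by (metis Suc_n_not_le_n enat_ord_simps(1) order.trans)
  with bound False show ?thesis by blast
qed

end
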